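(* Let $\omega\in(0,1)$, $w_2>0$ and $w_4>1$. Let $f$ be a real-valued function analytic on an open interval containing $[-2,2]$ with $V_M(f)\neq0$. Then, with $\lambda=\omega$ in the definition of $m_M(f)$, $$\left|\frac{m_M(f)-m_H(f)}{\sqrt{V_M(f)}}\right|\le\left|\frac{m_+-m_0}{\sqrt{V_0}}\right| .$$ Equality holds if and only if $f=C_1\phi_\omega+C_2$ (on $[-2,2]$) for some constants $C_1,C_2$, where $$\phi_\omega(x)=\log\Big(\frac{1}{1-\sqrt\omega x+\omega}\Big)+\sqrt\omega\Big(\frac{2}{w_2}-1\Big)x+\omega\Big(\frac{1}{w_4-1}-\frac12\Big)x^2 .$$
   Context: Chebyshev polynomials: $T_0(x)=1$, $T_1(x)=x$, $T_{n+1}(x)=2xT_n(x)-T_{n-1}(x)$. For $\ell\ge0$, $$\tau_\ell(f)=\frac1\pi\int_{-2}^2T_\ell\Big(\frac x2\Big)\frac{f(x)}{\sqrt{4-x^2}}\,dx.$$ The functionals (asymptotic mean and variance of the linear spectral statistic of $f$ for a spiked Wigner matrix with signal-to-noise ratio $\lambda$) are $$m_M(f)=\frac14\big(f(2)+f(-2)\big)-\frac12\tau_0(f)+(w_2-2)\tau_2(f)+(w_4-3)\tau_4(f)+\sum_{\ell=1}^\infty\sqrt{\lambda^\ell}\,\tau_\ell(f),$$ $$V_M(f)=(w_2-2)\tau_1(f)^2+2(w_4-3)\tau_2(f)^2+2\sum_{\ell=1}^\infty\ell\,\tau_\ell(f)^2,$$ and $m_H(f)$ is $m_M(f)$ with $\lambda=0$,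 i.e. without the last sum. The constants are $$m_0=-\frac12\log(1-\omega)+\Big(\frac{w_2-1}{w_4-1}-\frac12\Big)\omega+\frac{(w_4-3)\omega^2}{4},$$ $$m_+=m_0-\log(1-\omega)+\Big(\frac{2}{w_2}-1\Big)\omega+\Big(\frac{1}{w_4-1}-\frac12\Big)\omega^2,$$ $$V_0=-2\log(1-\omega)+\Big(\frac{4}{w_2}-2\Big)\omega+\Big(\frac{2}{w_4-1}-1\Big)\omega^2 .$$ *)

theory Defs
  imports "HOL-Analysis.Analysis"
begin

fun chebyshev_T :: "nat \<Rightarrow> real \<Rightarrow> real" where
  "chebyshev_T 0 x = 1"
| "chebyshev_T (Suc 0) x = x"
| "chebyshev_T (Suc (Suc n)) x = 2 * x * chebyshev_T (Suc n) x - chebyshev_T n x"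

(* The expansion is required on a full neighbourhood of each point, so for open S only the
   values of f on S matter. *)
definition real_analytic_on :: "(real \<Rightarrow> real) \<Rightarrow> real set \<Rightarrow> bool" where
  "real_analytic_on f S \<longleftrightarrow>
     (\<forall>x\<in>S. \<exists>a :: nat \<Rightarrow> real. \<exists>r>0. \<forall>y. \<bar>y - x\<bar> < r \<longrightarrow> (\<lambda>n. a n * (y - x) ^ n) sums f y)"

(* At the endpoints the integrand is 0 by the convention x / 0 = 0. *)
definition cheb_coeff :: "nat \<Rightarrow> (real \<Rightarrow> real) \<Rightarrow> real" where
  "cheb_coeff l f =
     1 / pi * integral {-2..2} (\<lambda>x. chebyshev_T l (x / 2) * (f x / sqrt (4 - x\<^sup>2)))"

(* The sums over l >= 1 below are written with the index Suc l. They converge for f analytic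
   near [-2,2] and 0 <= lam < 1, because cheb_coeff l f then decays exponentially in l. *)
definition m_M :: "real \<Rightarrow> real \<Rightarrow> real \<Rightarrow> (real \<Rightarrow> real) \<Rightarrow> real" where
  "m_M w2 w4 lam f =
     1 / 4 * (f 2 + f (-2)) - 1 / 2 * cheb_coeff 0 f
     + (w2 - 2) * cheb_coeff 2 f + (w4 - 3) * cheb_coeff 4 f
     + (\<Sum>l. sqrt (lam ^ Suc l) * cheb_coeff (Suc l) f)"

definition m_H :: "real \<Rightarrow> real \<Rightarrow> (real \<Rightarrow> real) \<Rightarrow> real" where
  "m_H w2 w4 f = m_M w2 w4 0 f"

definition V_M :: "real \<Rightarrow> real \<Rightarrow> (real \<Rightarrow> real) \<Rightarrow> real" where
  "V_M w2 w4 f =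
     (w2 - 2) * (cheb_coeff 1 f)\<^sup>2 + 2 * (w4 - 3) * (cheb_coeff 2 f)\<^sup>2
     + 2 * (\<Sum>l. real (Suc l) * (cheb_coeff (Suc l) f)\<^sup>2)"

definition m_zero :: "real \<Rightarrow> real \<Rightarrow> real \<Rightarrow> real" where
  "m_zero w2 w4 \<omega> =
     - 1 / 2 * ln (1 - \<omega>) + ((w2 - 1) / (w4 - 1) - 1 / 2) * \<omega> + (w4 - 3) * \<omega>\<^sup>2 / 4"

definition m_plus :: "real \<Rightarrow> real \<Rightarrow> real \<Rightarrow> real" where
  "m_plus w2 w4 \<omega> =
     m_zero w2 w4 \<omega> - ln (1 - \<omega>) + (2 / w2 - 1) * \<omega> + (1 / (w4 - 1) - 1 / 2) * \<omega>\<^sup>2"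

definition V_zero :: "real \<Rightarrow> real \<Rightarrow> real \<Rightarrow> real" where
  "V_zero w2 w4 \<omega> =
     - 2 * ln (1 - \<omega>) + (4 / w2 - 2) * \<omega> + (2 / (w4 - 1) - 1) * \<omega>\<^sup>2"

definition phi :: "real \<Rightarrow> real \<Rightarrow> real \<Rightarrow> real \<Rightarrow> real" where
  "phi w2 w4 \<omega> x =
     ln (1 / (1 - sqrt \<omega> * x + \<omega>)) + sqrt \<omega> * (2 / w2 - 1) * x
     + \<omega> * (1 / (w4 - 1) - 1 / 2) * x\<^sup>2"

end

theory Submission
  imports Defs
begin

text \<open>
  Write \<open>\<tau>\<^sub>l\<close> for the \<open>l\<close>-th Chebyshev coefficient of \<open>f\<close> and \<open>s = sqrt \<omega>\<close>. Only the
  \<open>\<tau>\<^sub>l\<close> with \<open>l \<ge> 1\<close> matter: the difference of means is the linear form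
  \<open>B = (\<Sum>l\<ge>1. s\<^sup>l \<tau>\<^sub>l)\<close>, and the variance is the weighted sum of squares
  \<open>V = (\<Sum>l\<ge>1. c\<^sub>l \<tau>\<^sub>l\<^sup>2)\<close> with positive weights \<open>w2\<close>, \<open>2 (w4 - 1)\<close>, and \<open>2 l\<close> for \<open>l \<ge> 3\<close>.
  Cauchy--Schwarz gives \<open>B\<^sup>2 \<le> K V\<close> with \<open>K = (\<Sum>l\<ge>1. s\<^bsup>2l\<^esup> / c\<^sub>l)\<close>, with equality precisely when
  \<open>\<tau>\<^sub>l\<close> is proportional to \<open>s\<^sup>l / c\<^sub>l\<close> (lemma \<open>weighted_Cauchy_Schwarz_series\<close>). The logarithmic
  series evaluates \<open>K\<close>: it is a quarter of \<open>V_zero\<close> and half of \<open>m_plus - m_zero\<close>, so the bound in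
  the theorem is \<open>sqrt K\<close>.

  For the equality case, the Chebyshev coefficients of \<open>phi\<close> are computed to be \<open>2 s\<^sup>l / c\<^sub>l\<close> for
  \<open>l \<ge> 1\<close> (lemma \<open>cheb_coeff_phi\<close>). A continuous function on \<open>[-2, 2]\<close> whose coefficients with
  \<open>l \<ge> 1\<close> all vanish is constant (lemma \<open>cheb_coeff_positive_zero_imp_const\<close>). Hence proportionality
  of the coefficients means that \<open>f\<close> is an affine function of \<open>phi\<close>.

  The substitution \<open>x = 2 cos t\<close> turns Chebyshev coefficients into cosine coefficients. Analyticity
  of \<open>f\<close> enters only through two derivatives: integrating by parts twice gives \<open>\<tau>\<^sub>l = O(1 / l\<^sup>2)\<close>,
  so that the series defining \<open>V\<close> converges.
\<close>

section \<open>Chebyshev coefficients as cosine coefficients\<close>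

lemma chebyshev_T_cos: "chebyshev_T l (cos t) = cos (real l * t)"
proof (induction l "cos t" rule: chebyshev_T.induct)
  case (3 n)
  have "cos (real (Suc (Suc n)) * t) + cos (real n * t) = 2 * cos t * cos (real (Suc n) * t)"
  proof -
    have "cos (real (Suc (Suc n)) * t) = cos (real (Suc n) * t + t)"
      and "cos (real n * t) = cos (real (Suc n) * t - t)"
      by (simp_all add: algebra_simps)
    then show ?thesis
      by (simp only: cos_add cos_diff) simp
  qed
  with 3 show ?case by simp
qed auto

lemma continuous_on_Icc_bounded:
  fixes f :: "real \<Rightarrow> real"
  assumes "continuous_on {a..b} f"
  obtains B where "\<And>t. t \<in> {a..b} \<Longrightarrow> \<bar>f t\<bar> \<le> B"
proof -
  have "bounded (f ` {a..b})"
    using assms by (intro compact_imp_bounded compact_continuous_image) auto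
  then obtain B where "\<forall>y\<in>f ` {a..b}. norm y \<le> B"
    unfolding bounded_iff by blast
  then show ?thesis
    by (intro that[of B]) auto
qed

lemma two_cos_mem: "2 * cos t \<in> {-2..2 :: real}"
  using cos_le_one[of t] cos_ge_minus_one[of t] unfolding atLeastAtMost_iff by linarith

lemma continuous_on_comp_2_cos:
  fixes f :: "real \<Rightarrow> real"
  assumes "continuous_on {-2..2} f"
  shows "continuous_on S (\<lambda>t. f (2 * cos t))"
proof (rule continuous_on_compose2[OF assms])
  show "continuous_on S (\<lambda>t. 2 * cos t)"
    by (intro continuous_intros)
qed (use two_cos_mem in blast)

text \<open>The integrand defining a Chebyshev coefficient may be unbounded near \<open>\<plusminus>2\<close>, so substitution
  rules for continuous integrands do not apply. If \<open>H\<close> is an antiderivative of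
  \<open>cos (l t) f (2 cos t)\<close>, however, then \<open>- H (arccos (x / 2))\<close> is an antiderivative
  of the integrand that is continuous up to the endpoints.\<close>

lemma has_integral_cheb_coeff:
  assumes f: "continuous_on {-2..2} f"
  shows "((\<lambda>t. cos (real l * t) * f (2 * cos t)) has_integral pi * cheb_coeff l f) {0..pi}"
proof -
  define h where "h t = cos (real l * t) * f (2 * cos t)" for t
  have h: "continuous_on {0..pi} h"
    unfolding h_def by (intro continuous_intros continuous_on_comp_2_cos f)
  define H where "H t = integral {0..t} h" for t
  have H': "(H has_real_derivative h t) (at t within {0..pi})" if "t \<in> {0..pi}" for t
    unfolding H_def using integral_has_real_derivative[OF h that] .
  then have Hc: "continuous_on {0..pi} H"
    by (meson DERIV_continuous continuous_on_eq_continuous_within)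
  have "((\<lambda>x. chebyshev_T l (x / 2) * (f x / sqrt (4 - x\<^sup>2))) has_integral
      (- H (arccos (2 / 2)) - - H (arccos (-2 / 2)))) {-2..2}"
  proof (rule fundamental_theorem_of_calculus_interior)
    show "continuous_on {-2..2} (\<lambda>x. - H (arccos (x / 2)))"
      by (intro continuous_intros continuous_on_compose2[OF Hc])
         (auto simp: arccos_lbound arccos_ubound)
  next
    fix x :: real
    assume x: "x \<in> {-2<..<2}"
    define t where "t = arccos (x / 2)"
    have t: "0 < t" "t < pi" and ct: "cos t = x / 2"
      using x arccos_lt_bounded[of "x / 2"] by (auto simp: t_def)
    have "at t within {0..pi} = at t"
      using t by (intro at_within_interior) auto
    then have Ht: "(H has_real_derivative h t) (at t)"
      using H'[of t] t by simp
    have "((\<lambda>x. arccos (x / 2)) has_real_derivative inverse (- sqrt (1 - (x / 2)\<^sup>2)) * (1 / 2)) (at x)"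
      using x by (auto intro!: derivative_eq_intros)
    from DERIV_minus[OF DERIV_chain2[where g = "\<lambda>x. arccos (x / 2)", OF Ht[unfolded t_def] this]]
    have D: "((\<lambda>x. - H (arccos (x / 2))) has_real_derivative
        - (h t * (inverse (- sqrt (1 - (x / 2)\<^sup>2)) * (1 / 2)))) (at x)"
      by (simp add: t_def)
    have "sqrt (4 - x\<^sup>2) = sqrt (4 * (1 - (x / 2)\<^sup>2))"
      by (simp add: power_divide)
    also have "\<dots> = 2 * sqrt (1 - (x / 2)\<^sup>2)"
      by (simp only: real_sqrt_mult) simp
    finally have "- (h t * (inverse (- sqrt (1 - (x / 2)\<^sup>2)) * (1 / 2)))
        = chebyshev_T l (x / 2) * (f x / sqrt (4 - x\<^sup>2))"
      using chebyshev_T_cos[of l t] by (simp add: h_def ct divide_simps)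
    with D show "((\<lambda>x. - H (arccos (x / 2))) has_vector_derivative
        chebyshev_T l (x / 2) * (f x / sqrt (4 - x\<^sup>2))) (at x)"
      by (simp add: has_real_derivative_iff_has_vector_derivative)
  qed auto
  then have "integral {-2..2} (\<lambda>x. chebyshev_T l (x / 2) * (f x / sqrt (4 - x\<^sup>2))) = H pi"
    by (auto simp: H_def dest: integral_unique)
  moreover have "(h has_integral H pi) {0..pi}"
    unfolding H_def using h by (intro integrable_integral integrable_continuous_real)
  ultimately show ?thesis
    by (simp add: cheb_coeff_def h_def[abs_def])
qed

lemma cheb_coeff_cong:
  assumes "\<And>x. x \<in> {-2..2} \<Longrightarrow> f x = g x"
  shows "cheb_coeff l f = cheb_coeff l g"
  unfolding cheb_coeff_def using assms by (metis (no_types, lifting) integral_cong)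

lemma cheb_coeff_eqI:
  assumes "continuous_on {-2..2} f"
    and "((\<lambda>t. cos (real l * t) * f (2 * cos t)) has_integral pi * c) {0..pi}"
  shows "cheb_coeff l f = c"
  using has_integral_unique[OF has_integral_cheb_coeff[OF assms(1)] assms(2)] by simp

lemma cheb_coeff_linear:
  assumes "continuous_on {-2..2} f" "continuous_on {-2..2} g"
  shows "cheb_coeff l (\<lambda>x. a * f x + b * g x) = a * cheb_coeff l f + b * cheb_coeff l g"
proof (rule cheb_coeff_eqI)
  show "((\<lambda>t. cos (real l * t) * (a * f (2 * cos t) + b * g (2 * cos t))) has_integral
      pi * (a * cheb_coeff l f + b * cheb_coeff l g)) {0..pi}"
    using has_integral_add[OF has_integral_mult_right[OF has_integral_cheb_coeff[OF assms(1)], of a]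
        has_integral_mult_right[OF has_integral_cheb_coeff[OF assms(2)], of b]]
    by (simp add: algebra_simps)
qed (intro continuous_intros assms)

lemma has_integral_cos_multiple:
  assumes "k \<noteq> 0"
  shows "((\<lambda>t. cos (of_int k * t)) has_integral 0) {0..pi}"
proof -
  have "((\<lambda>t. cos (of_int k * t)) has_integral
      sin (of_int k * pi) / of_int k - sin (of_int k * 0) / of_int k) {0..pi}"
    by (rule fundamental_theorem_of_calculus)
       (use assms in \<open>auto intro!: derivative_eq_intros
          simp: has_real_derivative_iff_has_vector_derivative[symmetric]\<close>)
  moreover have "sin (of_int k * pi) = 0"
    using sin_times_pi_eq_0[of "of_int k"] by simp
  ultimately show ?thesis by simp
qed

lemma has_integral_cos_cos:
  assumes "0 < l"
  shows "((\<lambda>t. cos (real l * t) * cos (real n * t)) has_integral (if n = l then pi / 2 else 0)) {0..pi}"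
proof -
  have "((\<lambda>t. cos (of_int (int l - int n) * t)) has_integral (if n = l then pi else 0)) {0..pi}"
    using has_integral_cos_multiple[of "int l - int n"] has_integral_const_real[of "1 :: real" 0 pi] by auto
  moreover have "((\<lambda>t. cos (of_int (int l + int n) * t)) has_integral 0) {0..pi}"
    using assms by (intro has_integral_cos_multiple) auto
  ultimately have "((\<lambda>t. (cos (of_int (int l - int n) * t) + cos (of_int (int l + int n) * t)) / 2)
      has_integral ((if n = l then pi else 0) + 0) / 2) {0..pi}"
    by (intro has_integral_divide has_integral_add)
  then show ?thesis
    by (cases "n = l") (simp_all add: cos_times_cos ring_distribs mult.commute mult.left_commute)
qed

text \<open>An absolutely convergent cosine series converges uniformly, so it can be integrated term by
  term; orthogonality leaves one term.\<close>

lemma cheb_coeff_cosine_series: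
  assumes f: "continuous_on {-2..2} f" and a: "summable (\<lambda>n. \<bar>a n\<bar>)"
    and series: "\<And>t. (\<lambda>n. a n * cos (real n * t)) sums f (2 * cos t)"
    and l: "0 < l"
  shows "cheb_coeff l f = a l / 2"
proof -
  define F where "F n t = cos (real l * t) * (a n * cos (real n * t))" for n t
  have "norm (F n t) \<le> \<bar>a n\<bar>" for n t
  proof -
    have "norm (F n t) = \<bar>cos (real l * t)\<bar> * \<bar>cos (real n * t)\<bar> * \<bar>a n\<bar>"
      by (simp add: F_def abs_mult)
    also have "\<dots> \<le> 1 * 1 * \<bar>a n\<bar>"
      by (intro mult_mono) auto
    finally show ?thesis by simp
  qed
  then have "uniform_limit {0..pi} (\<lambda>n t. \<Sum>i<n. F i t) (\<lambda>t. suminf (\<lambda>i. F i t)) sequentially"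
    using a by (intro Weierstrass_m_test)
  moreover have "suminf (\<lambda>i. F i t) = cos (real l * t) * f (2 * cos t)" for t
    unfolding F_def using sums_mult[OF series[of t]] by (rule sums_unique[symmetric])
  ultimately have "uniform_limit {0..pi} (\<lambda>n t. \<Sum>i<n. F i t)
      (\<lambda>t. cos (real l * t) * f (2 * cos t)) sequentially"
    by simp
  then obtain P J where P: "\<And>n. ((\<lambda>t. \<Sum>i<n. F i t) has_integral P n) {0..pi}"
    and J: "((\<lambda>t. cos (real l * t) * f (2 * cos t)) has_integral J) {0..pi}"
    and PJ: "P \<longlonglongrightarrow> J"
    by (rule uniform_limit_integral) (auto simp: F_def intro!: continuous_intros)
  have "((\<lambda>t. \<Sum>i<n. F i t) has_integral (\<Sum>i<n. a i * (if i = l then pi / 2 else 0))) {0..pi}" for n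
  proof (rule has_integral_sum)
    show "(F i has_integral a i * (if i = l then pi / 2 else 0)) {0..pi}" for i
      using has_integral_mult_right[OF has_integral_cos_cos[OF l, of i], of "a i"]
      by (simp add: F_def[abs_def] ac_simps)
  qed auto
  then have "P = (\<lambda>n. \<Sum>i<n. a i * (if i = l then pi / 2 else 0))"
    using P has_integral_unique by blast
  then have "(\<lambda>i. a i * (if i = l then pi / 2 else 0)) sums J"
    using PJ by (simp add: sums_def)
  moreover have "(\<lambda>i. a i * (if i = l then pi / 2 else 0)) sums (a l * (pi / 2))"
    using sums_single[of l "\<lambda>i. a i * (pi / 2)"] by (simp add: if_distrib cong: if_cong)
  ultimately have "J = pi * (a l / 2)"
    using sums_unique2 by fastforce
  with J show ?thesis
    by (intro cheb_coeff_eqI[OF f]) simp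
qed

section \<open>Decay of the coefficients\<close>

text \<open>Two integrations by parts, done in one step: the derivative of
  \<open>sin (l t) g t / l + cos (l t) g' t / l\<^sup>2\<close>, for \<open>g t = f (2 cos t)\<close>, is
  \<open>cos (l t) (g t + g'' t / l\<^sup>2)\<close>. No boundary terms survive, because
  \<open>sin (l t)\<close> and \<open>g' t = - 2 sin t f' (2 cos t)\<close> both vanish at \<open>0\<close> and \<open>\<pi>\<close>.\<close>

lemma cheb_coeff_quadratic_decay:
  assumes f: "\<And>x. x \<in> {-2..2} \<Longrightarrow> (f has_real_derivative f' x) (at x)"
    and f': "\<And>x. x \<in> {-2..2} \<Longrightarrow> (f' has_real_derivative f'' x) (at x)"
    and f'': "continuous_on {-2..2} f''"
  obtains M where "\<And>l. 0 < l \<Longrightarrow> \<bar>cheb_coeff l f\<bar> \<le> M / (real l)\<^sup>2"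
proof -
  have contf: "continuous_on {-2..2} f" and contf': "continuous_on {-2..2} f'"
    using f f' by (meson DERIV_isCont continuous_at_imp_continuous_on)+
  define g g' g'' where "g t = f (2 * cos t)" and "g' t = f' (2 * cos t) * (- 2 * sin t)"
    and "g'' t = f'' (2 * cos t) * (- 2 * sin t) * (- 2 * sin t) + f' (2 * cos t) * (- 2 * cos t)"
    for t
  have dg: "(g has_real_derivative g' t) (at t)" for t
    unfolding g_def g'_def
    by (rule DERIV_chain2[where g = "\<lambda>t. 2 * cos t", OF f[OF two_cos_mem]]) (auto intro!: derivative_eq_intros)
  have dg': "(g' has_real_derivative g'' t) (at t)" for t
  proof -
    have "((\<lambda>t. f' (2 * cos t)) has_real_derivative f'' (2 * cos t) * (- 2 * sin t)) (at t)"
      by (rule DERIV_chain2[where g = "\<lambda>t. 2 * cos t", OF f'[OF two_cos_mem]]) (auto intro!: derivative_eq_intros)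
    then show ?thesis
      unfolding g'_def g''_def by (auto intro!: derivative_eq_intros)
  qed
  have contg'': "continuous_on {0..pi} g''"
    unfolding g''_def by (intro continuous_intros continuous_on_comp_2_cos f'' contf')
  obtain B where B: "\<And>t. t \<in> {0..pi} \<Longrightarrow> \<bar>g'' t\<bar> \<le> B"
    using continuous_on_Icc_bounded[OF contg''] by blast
  have "\<bar>cheb_coeff l f\<bar> \<le> B / (real l)\<^sup>2" if l: "0 < l" for l
  proof -
    define R where "R = (\<lambda>t. cos (real l * t) * g'' t)"
    define G where "G = (\<lambda>t. sin (real l * t) * g t / real l + cos (real l * t) * g' t / (real l)\<^sup>2)"
    have "((\<lambda>t. cos (real l * t) * g t + R t / (real l)\<^sup>2) has_integral G pi - G 0) {0..pi}"
    proof (rule fundamental_theorem_of_calculus)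
      fix t :: real
      have "(G has_real_derivative cos (real l * t) * g t + R t / (real l)\<^sup>2) (at t)"
        unfolding G_def R_def using l
        by (auto intro!: derivative_eq_intros dg dg' simp: field_simps power2_eq_square)
      then show "(G has_vector_derivative cos (real l * t) * g t + R t / (real l)\<^sup>2)
          (at t within {0..pi})"
        by (simp add: has_real_derivative_iff_has_vector_derivative has_vector_derivative_at_within)
    qed auto
    moreover have "G pi - G 0 = 0"
      using sin_times_pi_eq_0[of "real l"] by (simp add: G_def g'_def)
    moreover have contR: "continuous_on {0..pi} R"
      unfolding R_def by (intro continuous_intros contg'')
    then have "(R has_integral integral {0..pi} R) {0..pi}"
      by (intro integrable_integral integrable_continuous_real)
    ultimately have "((\<lambda>t. (cos (real l * t) * g t + R t / (real l)\<^sup>2) - R t / (real l)\<^sup>2)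
        has_integral 0 - integral {0..pi} R / (real l)\<^sup>2) {0..pi}"
      by (intro has_integral_diff has_integral_divide) auto
    then have "cheb_coeff l f = - integral {0..pi} R / (real l)\<^sup>2 / pi"
      by (intro cheb_coeff_eqI[OF contf]) (simp add: g_def)
    moreover have "norm (integral {0..pi} R) \<le> B * (pi - 0)"
    proof (rule integral_bound[OF _ contR])
      fix t :: real assume "t \<in> {0..pi}"
      then have "\<bar>cos (real l * t)\<bar> * \<bar>g'' t\<bar> \<le> 1 * B"
        by (intro mult_mono B) auto
      then show "norm (R t) \<le> B"
        by (simp add: R_def abs_mult)
    qed auto
    ultimately have "\<bar>cheb_coeff l f\<bar> = \<bar>integral {0..pi} R\<bar> / ((real l)\<^sup>2 * pi)"
      and le: "\<bar>integral {0..pi} R\<bar> \<le> B * pi"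
      by (simp_all add: abs_mult)
    then have "\<bar>cheb_coeff l f\<bar> \<le> B * pi / ((real l)\<^sup>2 * pi)"
      by (simp only: divide_right_mono zero_le_power2 pi_ge_zero mult_nonneg_nonneg)
    then show ?thesis by simp
  qed
  then show ?thesis by (rule that)
qed

text \<open>Around each point of \<open>S\<close> the power series of \<open>f\<close> can be differentiated term by term, so
  analyticity passes to the derivative and the lemma can be iterated.\<close>

lemma real_analytic_on_DERIV:
  assumes "real_analytic_on f S"
  shows "x \<in> S \<Longrightarrow> (f has_real_derivative deriv f x) (at x)"
    and "real_analytic_on (deriv f) S"
proof -
  have *: "\<exists>a r. 0 < r \<and> (\<forall>y. \<bar>y - x\<bar> < r \<longrightarrow>
      (f has_real_derivative deriv f y) (at y) \<and> (\<lambda>n. a n * (y - x) ^ n) sums deriv f y)"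
    if xS: "x \<in> S" for x
  proof -
    obtain a r where r: "r > 0" and a: "\<And>y. \<bar>y - x\<bar> < r \<Longrightarrow> (\<lambda>n. a n * (y - x) ^ n) sums f y"
      using assms[unfolded real_analytic_on_def, rule_format, OF xS] by metis
    have sm: "summable (\<lambda>n. a n * z ^ n)" if "norm z < r" for z
      using a[of "x + z"] that by (auto simp: sums_iff)
    have D: "(f has_real_derivative (\<Sum>n. diffs a n * (y - x) ^ n)) (at y)
        \<and> summable (\<lambda>n. diffs a n * (y - x) ^ n)" if y: "\<bar>y - x\<bar> < r" for y
    proof
      have "((\<lambda>z. \<Sum>n. a n * z ^ n) has_real_derivative (\<Sum>n. diffs a n * (y - x) ^ n)) (at (y - x))"
        using y by (intro termdiffs_strong'[of r] sm) auto
      then have "((\<lambda>y. \<Sum>n. a n * (y - x) ^ n) has_real_derivative (\<Sum>n. diffs a n * (y - x) ^ n)) (at y)"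
        using DERIV_shift[of "\<lambda>z. \<Sum>n. a n * z ^ n" _ y "- x"] by simp
      then show "(f has_real_derivative (\<Sum>n. diffs a n * (y - x) ^ n)) (at y)"
      proof (rule has_field_derivative_transform_within_open)
        show "open (ball x r)" "y \<in> ball x r"
          using y by (auto simp: dist_real_def)
        show "(\<Sum>n. a n * (z - x) ^ n) = f z" if "z \<in> ball x r" for z
          using a[of z] that by (auto simp: dist_real_def sums_iff)
      qed
      show "summable (\<lambda>n. diffs a n * (y - x) ^ n)"
        using y by (intro termdiff_converges[of _ r] sm) auto
    qed
    have "(f has_real_derivative deriv f y) (at y) \<and> (\<lambda>n. diffs a n * (y - x) ^ n) sums deriv f y"
      if "\<bar>y - x\<bar> < r" for y
    proof -
      note y = D[OF that]
      from y have "deriv f y = (\<Sum>n. diffs a n * (y - x) ^ n)"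
        by (intro DERIV_imp_deriv) (rule conjunct1)
      with y show ?thesis
        by (simp add: summable_sums)
    qed
    with r show ?thesis
      by (intro exI[of _ "diffs a"] exI[of _ r] conjI allI impI) auto
  qed
  show "(f has_real_derivative deriv f x) (at x)" if xS: "x \<in> S"
    using *[OF xS] by fastforce
  show "real_analytic_on (deriv f) S"
    unfolding real_analytic_on_def
  proof
    fix x assume "x \<in> S"
    from *[OF this] obtain a r where "0 < r"
      and "\<forall>y. \<bar>y - x\<bar> < r \<longrightarrow>
        (f has_real_derivative deriv f y) (at y) \<and> (\<lambda>n. a n * (y - x) ^ n) sums deriv f y"
      by (elim exE conjE)
    then show "\<exists>a r. 0 < r \<and> (\<forall>y. \<bar>y - x\<bar> < r \<longrightarrow> (\<lambda>n. a n * (y - x) ^ n) sums deriv f y)"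
      by (intro exI[of _ a] exI[of _ r]) simp
  qed
qed

lemma real_analytic_cheb_coeff_decay:
  assumes "real_analytic_on f S" "{-2..2} \<subseteq> S"
  obtains M where "\<And>l. 0 < l \<Longrightarrow> \<bar>cheb_coeff l f\<bar> \<le> M / (real l)\<^sup>2"
proof -
  note f' = real_analytic_on_DERIV[OF assms(1)]
  note f'' = real_analytic_on_DERIV[OF f'(2)]
  note f''' = real_analytic_on_DERIV[OF f''(2)]
  have "continuous_on {-2..2} (deriv (deriv f))"
    using f'''(1) assms(2) by (intro continuous_at_imp_continuous_on ballI DERIV_isCont) blast
  then obtain M where "\<And>l. 0 < l \<Longrightarrow> \<bar>cheb_coeff l f\<bar> \<le> M / (real l)\<^sup>2"
    using cheb_coeff_quadratic_decay[of f "deriv f" "deriv (deriv f)"] f'(1) f''(1) subsetD[OF assms(2)]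
    by metis
  then show ?thesis by (rule that)
qed

section \<open>Determination by the coefficients\<close>

text \<open>Orthogonality to all \<open>cos (l t)\<close> propagates to all \<open>cos\<^sup>k t cos (l t)\<close>, by the
  product formula \<open>2 cos t cos (l t) = cos ((l + 1) t) + cos ((l - 1) t)\<close>.\<close>

lemma has_integral_cos_power_zero:
  assumes "\<And>l. ((\<lambda>t. cos (real l * t) * h t) has_integral 0) {0..pi}"
  shows "((\<lambda>t. cos t ^ k * (cos (real l * t) * h t)) has_integral 0) {0..pi}"
proof (induction k arbitrary: l)
  case 0
  then show ?case using assms by simp
next
  case (Suc k)
  show ?case
  proof (cases l)
    case 0
    then show ?thesis
      using Suc[of 1] by (simp add: ac_simps)
  next
    case (Suc m)
    have "((\<lambda>t. (cos t ^ k * (cos (real (Suc l) * t) * h t) + cos t ^ k * (cos (real m * t) * h t)) / 2)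
        has_integral (0 + 0) / 2) {0..pi}"
      by (intro has_integral_divide has_integral_add Suc.IH)
    moreover have "(cos t ^ k * (cos (real (Suc l) * t) * h t) + cos t ^ k * (cos (real m * t) * h t)) / 2
        = cos t ^ Suc k * (cos (real l * t) * h t)" for t
    proof -
      have "cos (real (Suc l) * t) + cos (real m * t) = 2 * cos t * cos (real l * t)"
      proof -
        have "cos (real (Suc l) * t) = cos (real l * t + t)" "cos (real m * t) = cos (real l * t - t)"
          using Suc by (simp_all add: algebra_simps)
        then show ?thesis by (simp only: cos_add cos_diff) simp
      qed
      then have "cos t ^ k * (cos (real (Suc l) * t) + cos (real m * t)) * h t / 2
          = cos t ^ Suc k * (cos (real l * t) * h t)"
        by simp
      then show ?thesis by (simp add: algebra_simps)
    qed
    ultimately show ?thesis by simp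
  qed
qed

text \<open>A function orthogonal to all polynomials is, by Weierstrass approximation, orthogonal to
  itself.\<close>

lemma cheb_coeff_zero_imp_zero:
  assumes h: "continuous_on {-2..2} h" and zero: "\<And>l. cheb_coeff l h = 0" and x: "x \<in> {-2..2}"
  shows "h x = 0"
proof -
  define k where "k t = h (2 * cos t)" for t
  have k: "continuous_on {0..pi} k"
    unfolding k_def by (rule continuous_on_comp_2_cos[OF h])
  have "((\<lambda>t. cos (real l * t) * k t) has_integral 0) {0..pi}" for l
    using has_integral_cheb_coeff[OF h, of l] zero by (simp add: k_def)
  from has_integral_cos_power_zero[OF this, of _ 0]
  have pow: "((\<lambda>t. cos t ^ i * k t) has_integral 0) {0..pi}" for i
    by simp
  have k2: "continuous_on {0..pi} (\<lambda>t. k t * k t)"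
    by (intro continuous_intros k)
  obtain B where B: "\<And>t. t \<in> {0..pi} \<Longrightarrow> \<bar>k t\<bar> \<le> B"
    using continuous_on_Icc_bounded[OF k] by blast
  have "B \<ge> 0" using B[of 0] by auto
  have small: "\<bar>integral {0..pi} (\<lambda>t. k t * k t)\<bar> \<le> e * (B * pi)" if e: "e > 0" for e
  proof -
    have mem: "2 * x \<in> {-2..2}" if "x \<in> {-1..1}" for x :: real
      using that by auto
    have "continuous_on {-1..1} (\<lambda>x. h (2 * x))"
      by (rule continuous_on_compose2[OF h]) (auto intro!: continuous_intros)
    from Stone_Weierstrass_real_polynomial_function[OF _ this e]
    obtain p where p: "real_polynomial_function p"
      and hp: "\<And>x. x \<in> {-1..1} \<Longrightarrow> \<bar>h (2 * x) - p x\<bar> < e"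
      by auto
    obtain a n where a: "p = (\<lambda>x. \<Sum>i\<le>n. a i * x ^ i)"
      using p real_polynomial_function_iff_sum by auto
    have "((\<lambda>t. \<Sum>i\<le>n. a i * (cos t ^ i * k t)) has_integral (\<Sum>i\<le>n. a i * 0)) {0..pi}"
      by (intro has_integral_sum has_integral_mult_right pow) auto
    then have "((\<lambda>t. p (cos t) * k t) has_integral 0) {0..pi}"
      by (simp add: a sum_distrib_right mult.assoc)
    from has_integral_diff[OF integrable_integral[OF integrable_continuous_real[OF k2]] this]
    have "integral {0..pi} (\<lambda>t. k t * k t) = integral {0..pi} (\<lambda>t. k t * k t - p (cos t) * k t)"
      by (simp add: integral_unique)
    also have "norm \<dots> \<le> (e * B) * (pi - 0)"
    proof (rule integral_bound)
      have "continuous_on UNIV (\<lambda>t. p (cos t))"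
        unfolding a by (intro continuous_intros)
      then show "continuous_on {0..pi} (\<lambda>t. k t * k t - p (cos t) * k t)"
        using k by (intro continuous_intros) (auto intro: continuous_on_subset)
      fix t :: real assume t: "t \<in> {0..pi}"
      have "\<bar>h (2 * cos t) - p (cos t)\<bar> * \<bar>k t\<bar> \<le> e * B"
        using e hp[of "cos t"] by (intro mult_mono B[OF t]) auto
      then show "norm (k t * k t - p (cos t) * k t) \<le> e * B"
        by (simp add: k_def abs_mult[symmetric] algebra_simps)
    qed auto
    finally show ?thesis by (simp add: ac_simps)
  qed
  have "\<bar>integral {0..pi} (\<lambda>t. k t * k t)\<bar> \<le> 0"
  proof (rule field_le_epsilon)
    fix e :: real assume "e > 0"
    moreover have "B * pi + 1 > 0" using \<open>B \<ge> 0\<close> by (simp add: add_nonneg_pos)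
    ultimately have "\<bar>integral {0..pi} (\<lambda>t. k t * k t)\<bar> \<le> e / (B * pi + 1) * (B * pi)"
      by (intro small) auto
    also have "\<dots> \<le> e"
      using \<open>e > 0\<close> \<open>B * pi + 1 > 0\<close> by (simp add: field_simps)
    finally show "\<bar>integral {0..pi} (\<lambda>t. k t * k t)\<bar> \<le> 0 + e" by simp
  qed
  then have "integral {0..pi} (\<lambda>t. k t * k t) = 0" by simp
  then have "\<forall>t\<in>{0..pi}. k t * k t = 0"
    using integral_eq_0_iff[OF k2] by simp
  moreover have "arccos (x / 2) \<in> {0..pi}"
    using x by (auto intro: arccos_lbound arccos_ubound)
  ultimately have "k (arccos (x / 2)) = 0" by auto
  then show ?thesis using x by (simp add: k_def)
qed

lemma cheb_coeff_const: "cheb_coeff l (\<lambda>_. c) = (if l = 0 then c else 0)"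
proof (rule cheb_coeff_eqI)
  show "((\<lambda>t. cos (real l * t) * c) has_integral pi * (if l = 0 then c else 0)) {0..pi}"
    using has_integral_mult_left[OF has_integral_cos_multiple[of "int l"], of c]
      has_integral_const_real[of c 0 pi] by auto
qed auto

lemma cheb_coeff_positive_zero_imp_const:
  assumes h: "continuous_on {-2..2} h" and zero: "\<And>l. 0 < l \<Longrightarrow> cheb_coeff l h = 0"
    and x: "x \<in> {-2..2}"
  shows "h x = cheb_coeff 0 h"
proof -
  have "1 * h x + (-1) * cheb_coeff 0 h = 0"
  proof (rule cheb_coeff_zero_imp_zero[OF _ _ x])
    show "cheb_coeff l (\<lambda>x. 1 * h x + (-1) * cheb_coeff 0 h) = 0" for l
      by (subst cheb_coeff_linear[OF h]) (use zero in \<open>auto simp: cheb_coeff_const\<close>)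
  qed (intro continuous_intros h)
  then show ?thesis by simp
qed

section \<open>The equality case of a weighted Cauchy--Schwarz inequality\<close>

text \<open>With \<open>B = (\<Sum>n. x n * y n)\<close> and \<open>t = B / K\<close> the defect is a sum of squares:
  \<open>V - B\<^sup>2 / K = (\<Sum>n. c n * (x n - t * (y n / c n))\<^sup>2)\<close>. It is therefore nonnegative, and it
  vanishes only if every square does.\<close>

lemma weighted_Cauchy_Schwarz_series:
  fixes c x y :: "nat \<Rightarrow> real"
  assumes c: "\<And>n. 0 < c n"
    and V: "(\<lambda>n. c n * (x n)\<^sup>2) sums V" and K: "(\<lambda>n. (y n)\<^sup>2 / c n) sums K" and K0: "0 < K"
  shows "(\<Sum>n. x n * y n)\<^sup>2 \<le> K * V"
    and "(\<Sum>n. x n * y n)\<^sup>2 = K * V \<longleftrightarrow> (\<exists>t. \<forall>n. x n = t * (y n / c n))"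
proof -
  define B where "B = (\<Sum>n. x n * y n)"
  define t where "t = B / K"
  have "summable (\<lambda>n. x n * y n)"
  proof (rule summable_comparison_test)
    have "\<bar>x n * y n\<bar> \<le> c n * (x n)\<^sup>2 + (y n)\<^sup>2 / c n" for n
    proof -
      have "0 \<le> (c n * \<bar>x n\<bar> - \<bar>y n\<bar>)\<^sup>2 / c n"
        using c[of n] by simp
      also have "\<dots> = c n * (x n)\<^sup>2 + (y n)\<^sup>2 / c n - 2 * \<bar>x n * y n\<bar>"
        using c[of n] by (simp add: power2_diff abs_mult field_simps power2_eq_square)
      finally show ?thesis by (smt (verit) abs_ge_zero)
    qed
    then show "\<exists>N. \<forall>n\<ge>N. norm (x n * y n) \<le> c n * (x n)\<^sup>2 + (y n)\<^sup>2 / c n"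
      by simp
    show "summable (\<lambda>n. c n * (x n)\<^sup>2 + (y n)\<^sup>2 / c n)"
      using V K by (intro summable_add) (auto simp: sums_iff)
  qed
  then have xy: "(\<lambda>n. x n * y n) sums B"
    by (simp add: B_def summable_sums)
  define d where "d n = c n * (x n - t * (y n / c n))\<^sup>2" for n
  have d0: "0 \<le> d n" for n
    using c[of n] by (simp add: d_def)
  have "(\<lambda>n. c n * (x n)\<^sup>2 - 2 * t * (x n * y n) + t\<^sup>2 * ((y n)\<^sup>2 / c n)) sums
      (V - 2 * t * B + t\<^sup>2 * K)"
    by (intro sums_add sums_diff sums_mult V K xy)
  also have "(\<lambda>n. c n * (x n)\<^sup>2 - 2 * t * (x n * y n) + t\<^sup>2 * ((y n)\<^sup>2 / c n)) = d"
  proof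
    fix n
    show "c n * (x n)\<^sup>2 - 2 * t * (x n * y n) + t\<^sup>2 * ((y n)\<^sup>2 / c n) = d n"
      using c[of n] by (simp add: d_def power2_eq_square field_simps)
  qed
  also have "V - 2 * t * B + t\<^sup>2 * K = V - B\<^sup>2 / K"
    using K0 by (simp add: t_def power2_eq_square field_simps)
  finally have d: "d sums (V - B\<^sup>2 / K)" .
  then have "0 \<le> V - B\<^sup>2 / K"
    using d0 by (metis sums_iff suminf_nonneg)
  then show "(\<Sum>n. x n * y n)\<^sup>2 \<le> K * V"
    unfolding B_def[symmetric] using K0 by (simp add: field_simps)
  have "(\<Sum>n. x n * y n)\<^sup>2 = K * V" if "\<And>n. x n = r * (y n / c n)" for r
  proof -
    have "(\<lambda>n. r * ((y n)\<^sup>2 / c n)) sums (r * K)"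
      by (intro sums_mult K)
    then have "B = r * K"
      unfolding B_def by (simp add: that power2_eq_square sums_iff mult.assoc)
    moreover have "(\<lambda>n. r\<^sup>2 * ((y n)\<^sup>2 / c n)) sums (r\<^sup>2 * K)"
      by (intro sums_mult K)
    moreover have "r\<^sup>2 * ((y n)\<^sup>2 / c n) = c n * (x n)\<^sup>2" for n
      using c[of n] by (simp add: that power2_eq_square)
    ultimately show ?thesis
      using sums_unique2[OF V, of "r\<^sup>2 * K"] by (simp add: B_def[symmetric] power2_eq_square)
  qed
  moreover have "\<forall>n. x n = t * (y n / c n)" if "B\<^sup>2 = K * V"
  proof -
    have "d sums 0"
      using d that K0 by simp
    then have "\<forall>n. d n = 0"
      using d0 suminf_eq_zero_iff[of d] by (auto simp: sums_iff)
    then show ?thesis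
      using c unfolding d_def by (metis eq_iff_diff_eq_0 less_irrefl mult_eq_0_iff zero_eq_power2)
  qed
  ultimately show "(\<Sum>n. x n * y n)\<^sup>2 = K * V \<longleftrightarrow> (\<exists>t. \<forall>n. x n = t * (y n / c n))"
    unfolding B_def[symmetric] by blast
qed

section \<open>The functionals as series\<close>

definition variance_weight :: "real \<Rightarrow> real \<Rightarrow> nat \<Rightarrow> real" where
  "variance_weight w2 w4 l = (if l = 1 then w2 else if l = 2 then 2 * (w4 - 1) else 2 * real l)"

lemma variance_weight_pos:
  "0 < w2 \<Longrightarrow> 1 < w4 \<Longrightarrow> 0 < l \<Longrightarrow> 0 < variance_weight w2 w4 l"
  by (simp add: variance_weight_def)

text \<open>The terms of \<open>V_M\<close> outside its series change the weights \<open>2 l\<close> of the series only for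
  \<open>l = 1\<close> and \<open>l = 2\<close>. Splitting the value like this requires the series to converge; this is where
  the decay of the coefficients is used.\<close>

lemma V_M_sums:
  assumes "\<And>l. 0 < l \<Longrightarrow> \<bar>cheb_coeff l f\<bar> \<le> M / (real l)\<^sup>2"
  shows "(\<lambda>n. variance_weight w2 w4 (Suc n) * (cheb_coeff (Suc n) f)\<^sup>2) sums V_M w2 w4 f"
proof -
  let ?q = "\<lambda>n. (cheb_coeff (Suc n) f)\<^sup>2"
  have "summable (\<lambda>n. real (Suc n) * ?q n)"
  proof (rule summable_comparison_test)
    have "real (Suc n) * ?q n \<le> M\<^sup>2 * inverse (real (Suc n) ^ 3)" for n
    proof -
      have "?q n \<le> (M / (real (Suc n))\<^sup>2)\<^sup>2"
        using power_mono[OF assms[of "Suc n"], of 2] by simp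
      then have "real (Suc n) * ?q n \<le> real (Suc n) * (M / (real (Suc n))\<^sup>2)\<^sup>2"
        by (intro mult_left_mono) auto
      also have "\<dots> = M\<^sup>2 * inverse (real (Suc n) ^ 3)"
        by (simp add: field_simps power2_eq_square power3_eq_cube del: of_nat_Suc)
      finally show ?thesis .
    qed
    then show "\<exists>N. \<forall>n\<ge>N. norm (real (Suc n) * ?q n) \<le> M\<^sup>2 * inverse (real (Suc n) ^ 3)"
      by (simp del: of_nat_Suc)
    have "summable (\<lambda>n. inverse (real n ^ 3))"
      by (rule inverse_power_summable) simp
    then show "summable (\<lambda>n. M\<^sup>2 * inverse (real (Suc n) ^ 3))"
      using summable_Suc_iff[of "\<lambda>n. inverse (real n ^ 3)"] by (intro summable_mult) simp
  qed
  then have *: "(\<lambda>n. 2 * (real (Suc n) * ?q n) + (if n = 0 then (w2 - 2) * ?q n else 0)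
      + (if n = 1 then 2 * (w4 - 3) * ?q n else 0)) sums
      (2 * (\<Sum>n. real (Suc n) * ?q n) + (w2 - 2) * ?q 0 + 2 * (w4 - 3) * ?q 1)"
    by (intro sums_add sums_mult sums_single summable_sums)
  have "(\<lambda>n. 2 * (real (Suc n) * ?q n) + (if n = 0 then (w2 - 2) * ?q n else 0)
      + (if n = 1 then 2 * (w4 - 3) * ?q n else 0)) = (\<lambda>n. variance_weight w2 w4 (Suc n) * ?q n)"
    by (auto simp: variance_weight_def fun_eq_iff algebra_simps)
  with * show ?thesis
    by (simp add: V_M_def numeral_2_eq_2 algebra_simps)
qed

lemma m_M_minus_m_H:
  "m_M w2 w4 \<omega> f - m_H w2 w4 f = (\<Sum>n. cheb_coeff (Suc n) f * sqrt \<omega> ^ Suc n)"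
  by (simp add: m_H_def m_M_def real_sqrt_power mult.commute del: power_Suc)

text \<open>The real part of the Taylor series of \<open>- log (1 - z)\<close> at \<open>z = s exp (i t)\<close>.\<close>

lemma cosine_log_sums:
  fixes s t :: real
  assumes s: "\<bar>s\<bar> < 1"
  shows "(\<lambda>n. s ^ n / real n * cos (real n * t)) sums (- ln (1 - 2 * s * cos t + s\<^sup>2) / 2)"
proof -
  define z where "z = - (of_real s * cis t)"
  have nz: "cmod z < 1"
    using s by (simp add: z_def norm_mult)
  then have z1: "1 + z \<noteq> 0"
    by (metis add.inverse_unique less_irrefl norm_minus_cancel norm_one)
  have "(cmod (1 + z))\<^sup>2 = (1 - s * cos t)\<^sup>2 + (s * sin t)\<^sup>2"
    by (simp add: cmod_power2 z_def)
  also have "\<dots> = 1 - 2 * s * cos t + s\<^sup>2 * ((cos t)\<^sup>2 + (sin t)\<^sup>2)"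
    by (simp only: power2_diff power_mult_distrib) (simp add: algebra_simps del: sin_cos_squared_add2)
  finally have sq: "(cmod (1 + z))\<^sup>2 = 1 - 2 * s * cos t + s\<^sup>2" by simp
  have "Re (ln (1 + z)) = ln (cmod (1 + z))"
    using z1 by simp
  also have "\<dots> = ln ((cmod (1 + z))\<^sup>2) / 2"
    using z1 by (simp add: ln_realpow)
  finally have Re: "Re (ln (1 + z)) = ln (1 - 2 * s * cos t + s\<^sup>2) / 2"
    by (simp add: sq)
  have "(\<lambda>n. - Re (- ((- z) ^ n) / of_nat n)) sums - Re (ln (1 + z))"
    using Ln_series'[OF nz] by (intro sums_minus sums_Re)
  moreover have "- Re (- ((- z) ^ n) / of_nat n) = s ^ n / real n * cos (real n * t)" for n
  proof -
    have "(- z) ^ n = of_real (s ^ n) * cis (real n * t)"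
      by (simp add: z_def power_mult_distrib Complex.DeMoivre)
    then show ?thesis
      by simp
  qed
  ultimately have "(\<lambda>n. s ^ n / real n * cos (real n * t)) sums
      - (ln (1 - 2 * s * cos t + s\<^sup>2) / 2)"
    by (simp only: Re)
  then show ?thesis by simp
qed

lemma V_zero_sums:
  assumes w: "0 < \<omega>" "\<omega> < 1"
  shows "(\<lambda>n. (sqrt \<omega> ^ Suc n)\<^sup>2 / variance_weight w2 w4 (Suc n)) sums (V_zero w2 w4 \<omega> / 4)"
proof -
  define p where "p = w4 - 1"
  have "1 - 2 * \<omega> + \<omega>\<^sup>2 = (1 - \<omega>)\<^sup>2"
    by (simp add: power2_eq_square algebra_simps)
  then have "(\<lambda>n. \<omega> ^ n / real n) sums - ln (1 - \<omega>)"
    using cosine_log_sums[of \<omega> 0] w by (simp add: ln_realpow)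
  then have "(\<lambda>n. \<omega> ^ Suc n / real (Suc n)) sums - ln (1 - \<omega>)"
    by (subst sums_Suc_iff) simp
  then have *: "(\<lambda>n. 1 / 2 * (\<omega> ^ Suc n / real (Suc n)) + (if n = 0 then \<omega> / w2 - \<omega> / 2 else 0)
      + (if n = 1 then \<omega>\<^sup>2 / (2 * (w4 - 1)) - \<omega>\<^sup>2 / 4 else 0)) sums
      (1 / 2 * (- ln (1 - \<omega>)) + (\<omega> / w2 - \<omega> / 2) + (\<omega>\<^sup>2 / (2 * (w4 - 1)) - \<omega>\<^sup>2 / 4))"
    by (intro sums_add sums_mult sums_single)
  have "(sqrt \<omega> ^ Suc n)\<^sup>2 = \<omega> ^ Suc n" for n
    using w by (metis less_imp_le power_even_eq power_mult real_sqrt_pow2)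
  then have "(\<lambda>n. 1 / 2 * (\<omega> ^ Suc n / real (Suc n)) + (if n = 0 then \<omega> / w2 - \<omega> / 2 else 0)
      + (if n = 1 then \<omega>\<^sup>2 / (2 * (w4 - 1)) - \<omega>\<^sup>2 / 4 else 0))
      = (\<lambda>n. (sqrt \<omega> ^ Suc n)\<^sup>2 / variance_weight w2 w4 (Suc n))"
    by (auto simp: variance_weight_def fun_eq_iff power2_eq_square)
  moreover have "1 / 2 * (- ln (1 - \<omega>)) + (\<omega> / w2 - \<omega> / 2) + (\<omega>\<^sup>2 / (2 * (w4 - 1)) - \<omega>\<^sup>2 / 4)
      = V_zero w2 w4 \<omega> / 4"
    unfolding V_zero_def p_def[symmetric] by (simp add: field_simps)
  ultimately show ?thesis
    using * by (simp only:)
qed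

section \<open>The extremal function\<close>

lemma continuous_on_phi:
  assumes w: "0 < \<omega>" "\<omega> < 1"
  shows "continuous_on {-2..2} (phi w2 w4 \<omega>)"
proof -
  have pos: "1 - sqrt \<omega> * x + \<omega> > 0" if "x \<in> {-2..2}" for x
  proof -
    have "sqrt \<omega> * x \<le> sqrt \<omega> * 2"
      using that w by (intro mult_left_mono) auto
    moreover have "0 < (1 - sqrt \<omega>)\<^sup>2"
      using w by simp
    then have "0 < 1 - 2 * sqrt \<omega> + \<omega>"
      using w by (simp add: power2_diff)
    ultimately show ?thesis by linarith
  qed
  show ?thesis
    unfolding phi_def[abs_def] by (intro continuous_intros) (use pos in force)+
qed

text \<open>The cosine series of \<open>phi\<close>: the logarithm contributes \<open>2 s ^ l / l\<close> with \<open>s = sqrt \<omega>\<close>, and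
  the linear and the quadratic term change only the coefficients \<open>l = 1\<close> and \<open>l = 2\<close> (and the
  constant term), replacing the weights \<open>2\<close> and \<open>4\<close> there by \<open>w2\<close> and \<open>2 (w4 - 1)\<close>.\<close>

lemma cheb_coeff_phi:
  assumes w: "0 < \<omega>" "\<omega> < 1" and l: "0 < l"
  shows "cheb_coeff l (phi w2 w4 \<omega>) = 2 * (sqrt \<omega> ^ l / variance_weight w2 w4 l)"
proof -
  define s where "s = sqrt \<omega>"
  have s: "0 < s" "s < 1" "s\<^sup>2 = \<omega>"
    using w by (auto simp: s_def)
  define p where "p = w4 - 1"
  define k where "k = \<omega> * (1 / (w4 - 1) - 1 / 2)"
  define b where "b n = (if n = 0 then 2 * k else 4 * (s ^ n / variance_weight w2 w4 n))" for n
  have "cheb_coeff l (phi w2 w4 \<omega>) = b l / 2"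
  proof (rule cheb_coeff_cosine_series[OF continuous_on_phi[OF w] _ _ l])
    show "summable (\<lambda>n. \<bar>b n\<bar>)"
    proof (rule summable_comparison_test)
      have "\<bar>b n\<bar> \<le> 2 * s ^ n" if "n \<ge> 3" for n
        using that s by (simp add: b_def variance_weight_def abs_mult field_simps)
      then show "\<exists>N. \<forall>n\<ge>N. norm \<bar>b n\<bar> \<le> 2 * s ^ n" by auto
      show "summable (\<lambda>n. 2 * s ^ n)"
        using s by (intro summable_mult summable_geometric) simp
    qed
  next
    fix t :: real
    have *: "(\<lambda>n. 2 * (s ^ n / real n * cos (real n * t)) + (if n = 0 then 2 * k else 0)
        + (if n = 1 then s * (2 / w2 - 1) * 2 * cos t else 0) + (if n = 2 then 2 * k * cos (2 * t) else 0))
        sums (2 * (- ln (1 - 2 * s * cos t + s\<^sup>2) / 2) + 2 * k + s * (2 / w2 - 1) * 2 * cos t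
          + 2 * k * cos (2 * t))"
      using s by (intro sums_add sums_mult sums_single cosine_log_sums) auto
    have "2 * (s ^ n / real n * cos (real n * t)) + (if n = 0 then 2 * k else 0)
        + (if n = 1 then s * (2 / w2 - 1) * 2 * cos t else 0) + (if n = 2 then 2 * k * cos (2 * t) else 0)
        = b n * cos (real n * t)" for n
    proof -
      consider "n = 0" | "n = 1" | "n = 2" | "n > 2" by linarith
      then show ?thesis
        unfolding b_def k_def variance_weight_def p_def[symmetric]
        by cases (auto simp: s(3) algebra_simps)
    qed
    moreover have "2 * (- ln (1 - 2 * s * cos t + s\<^sup>2) / 2) + 2 * k + s * (2 / w2 - 1) * 2 * cos t
        + 2 * k * cos (2 * t) = phi w2 w4 \<omega> (2 * cos t)"
    proof -
      have "2 * k + 2 * k * cos (2 * t) = k * (2 * cos t)\<^sup>2"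
        unfolding cos_double_cos by (simp add: algebra_simps)
      moreover have "ln (1 / (1 - sqrt \<omega> * (2 * cos t) + \<omega>)) = - ln (1 - 2 * s * cos t + s\<^sup>2)"
        by (simp add: ln_div s_def[symmetric] s(3) ac_simps inverse_eq_divide[symmetric] ln_inverse)
      ultimately show ?thesis
        unfolding phi_def k_def[symmetric] s_def[symmetric] by (simp add: algebra_simps)
    qed
    ultimately show "(\<lambda>n. b n * cos (real n * t)) sums phi w2 w4 \<omega> (2 * cos t)"
      using * by simp
  qed
  then show ?thesis
    using l by (simp add: b_def s_def)
qed

text \<open>Coefficients with \<open>l \<ge> 1\<close> determine a continuous function up to an additive constant, and
  those of \<open>phi\<close> are \<open>2 s ^ l / c l\<close>; so the two constants are related by \<open>t = 2 * C1\<close>.\<close>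

lemma eq_phi_iff_cheb_coeff:
  assumes w: "0 < \<omega>" "\<omega> < 1" and f: "continuous_on {-2..2} f"
  shows "(\<exists>C1 C2. \<forall>x\<in>{-2..2}. f x = C1 * phi w2 w4 \<omega> x + C2) \<longleftrightarrow>
    (\<exists>t. \<forall>n. cheb_coeff (Suc n) f = t * (sqrt \<omega> ^ Suc n / variance_weight w2 w4 (Suc n)))"
proof (intro iffI; elim exE)
  note phi = continuous_on_phi[OF w, of w2 w4]
  fix C1 C2
  assume *: "\<forall>x\<in>{-2..2}. f x = C1 * phi w2 w4 \<omega> x + C2"
  have "cheb_coeff (Suc n) f = 2 * C1 * (sqrt \<omega> ^ Suc n / variance_weight w2 w4 (Suc n))" for n
  proof -
    have "cheb_coeff (Suc n) f = cheb_coeff (Suc n) (\<lambda>x. C1 * phi w2 w4 \<omega> x + 1 * C2)"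
      using * by (intro cheb_coeff_cong) simp
    also have "\<dots> = C1 * cheb_coeff (Suc n) (phi w2 w4 \<omega>) + 1 * cheb_coeff (Suc n) (\<lambda>_. C2)"
      by (rule cheb_coeff_linear[OF phi]) simp
    finally show ?thesis
      by (simp add: cheb_coeff_phi[OF w] cheb_coeff_const del: power_Suc)
  qed
  then show "\<exists>t. \<forall>n. cheb_coeff (Suc n) f = t * (sqrt \<omega> ^ Suc n / variance_weight w2 w4 (Suc n))"
    by blast
next
  note phi = continuous_on_phi[OF w, of w2 w4]
  fix t
  assume t: "\<forall>n. cheb_coeff (Suc n) f = t * (sqrt \<omega> ^ Suc n / variance_weight w2 w4 (Suc n))"
  define h where "h x = 1 * f x + (- (t / 2)) * phi w2 w4 \<omega> x" for x
  have h: "continuous_on {-2..2} h"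
    unfolding h_def by (intro continuous_intros f phi)
  have "cheb_coeff l h = 0" if l: "0 < l" for l
  proof -
    obtain n where n: "l = Suc n"
      using l gr0_implies_Suc by blast
    have "cheb_coeff l h = 1 * cheb_coeff l f + (- (t / 2)) * cheb_coeff l (phi w2 w4 \<omega>)"
      unfolding h_def by (rule cheb_coeff_linear[OF f phi])
    then show ?thesis
      using t by (simp add: n cheb_coeff_phi[OF w] del: power_Suc)
  qed
  then have "\<forall>x\<in>{-2..2}. h x = cheb_coeff 0 h"
    using cheb_coeff_positive_zero_imp_const[OF h] by blast
  then have "\<forall>x\<in>{-2..2}. f x = (t / 2) * phi w2 w4 \<omega> x + cheb_coeff 0 h"
    by (simp add: h_def algebra_simps)
  then show "\<exists>C1 C2. \<forall>x\<in>{-2..2}. f x = C1 * phi w2 w4 \<omega> x + C2"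
    by blast
qed

theorem theorem7p4:
  fixes \<omega> w2 w4 :: real and f :: "real \<Rightarrow> real" and I :: "real set"
  assumes "0 < \<omega>" and "\<omega> < 1" and "0 < w2" and "1 < w4"
    and "open I" and "is_interval I" and "{-2..2} \<subseteq> I"
    and "real_analytic_on f I"
    and "V_M w2 w4 f \<noteq> 0"
  shows "\<bar>(m_M w2 w4 \<omega> f - m_H w2 w4 f) / sqrt (V_M w2 w4 f)\<bar>
           \<le> \<bar>(m_plus w2 w4 \<omega> - m_zero w2 w4 \<omega>) / sqrt (V_zero w2 w4 \<omega>)\<bar>
       \<and> (\<bar>(m_M w2 w4 \<omega> f - m_H w2 w4 f) / sqrt (V_M w2 w4 f)\<bar>
           = \<bar>(m_plus w2 w4 \<omega> - m_zero w2 w4 \<omega>) / sqrt (V_zero w2 w4 \<omega>)\<bar>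
          \<longleftrightarrow> (\<exists>C1 C2 :: real. \<forall>x\<in>{-2..2}. f x = C1 * phi w2 w4 \<omega> x + C2))"
proof -
  note w = assms(1,2)
  define c where "c n = variance_weight w2 w4 (Suc n)" for n
  define B V K where "B = m_M w2 w4 \<omega> f - m_H w2 w4 f" and "V = V_M w2 w4 f"
    and "K = V_zero w2 w4 \<omega> / 4"
  have c: "0 < c n" for n
    using assms(3,4) by (simp add: c_def variance_weight_pos)
  have f: "continuous_on {-2..2} f"
    using real_analytic_on_DERIV(1)[OF assms(8)] assms(7)
    by (intro continuous_at_imp_continuous_on ballI DERIV_isCont) blast
  obtain M where "\<And>l. 0 < l \<Longrightarrow> \<bar>cheb_coeff l f\<bar> \<le> M / (real l)\<^sup>2"
    using real_analytic_cheb_coeff_decay[OF assms(8,7)] by blast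
  from V_M_sums[OF this] have V_sums: "(\<lambda>n. c n * (cheb_coeff (Suc n) f)\<^sup>2) sums V"
    by (simp add: c_def V_def)
  have "0 \<le> V"
    by (rule sums_le[OF _ sums_zero V_sums]) (use c in \<open>auto simp: less_imp_le\<close>)
  with assms(9) have V: "0 < V"
    by (simp add: V_def)
  have K_sums: "(\<lambda>n. (sqrt \<omega> ^ Suc n)\<^sup>2 / c n) sums K"
    using V_zero_sums[OF w] by (simp add: c_def K_def)
  have K: "0 < K"
  proof -
    have "0 < (\<Sum>n. (sqrt \<omega> ^ Suc n)\<^sup>2 / c n)"
      using c w K_sums by (intro suminf_pos) (auto simp: sums_iff)
    with K_sums show ?thesis by (simp add: sums_iff)
  qed
  have B: "B = (\<Sum>n. cheb_coeff (Suc n) f * sqrt \<omega> ^ Suc n)"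
    by (simp only: B_def m_M_minus_m_H)
  note CS = weighted_Cauchy_Schwarz_series[OF c V_sums K_sums K, folded B]
  have lhs: "\<bar>B / sqrt V\<bar> = sqrt (B\<^sup>2 / V)"
    using V by (simp add: real_sqrt_divide)
  have "m_plus w2 w4 \<omega> - m_zero w2 w4 \<omega> = 2 * K" "V_zero w2 w4 \<omega> = 4 * K"
    by (simp_all add: m_plus_def K_def V_zero_def field_simps)
  then have "\<bar>(m_plus w2 w4 \<omega> - m_zero w2 w4 \<omega>) / sqrt (V_zero w2 w4 \<omega>)\<bar> = K / sqrt K"
    using K by (simp add: real_sqrt_mult)
  also have "\<dots> = sqrt K"
    using K by (simp add: real_div_sqrt)
  finally have rhs: "\<bar>(m_plus w2 w4 \<omega> - m_zero w2 w4 \<omega>) / sqrt (V_zero w2 w4 \<omega>)\<bar> = sqrt K" .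
  have "\<bar>B / sqrt V\<bar> \<le> sqrt K"
    unfolding lhs real_sqrt_le_iff using CS(1) V by (simp add: field_simps)
  moreover have "\<bar>B / sqrt V\<bar> = sqrt K \<longleftrightarrow> B\<^sup>2 = K * V"
    unfolding lhs real_sqrt_eq_iff using V by (simp add: field_simps)
  ultimately show ?thesis
    using CS(2) eq_phi_iff_cheb_coeff[OF w f, of w2 w4]
    unfolding B_def[symmetric] V_def[symmetric] rhs c_def by blast
qed

end
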